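(* Let $\mathcal{M}=((W,R,V),w_d)$ be a pointed model, let $k \geq 0$ and let $<$ be a total order on $W$. Then $\mathcal{M}$ is $k$-bisimilar to its $k$-contraction with respect to $<$.
   Context: Fix a countable set $\mathcal{P}$ of atomic propositions and a finite set $\mathcal{I}$ of modality indices. A model is $M=(W,R,V)$ with $W$ finite nonempty, $R_i\subseteq W\times W$ for $i\in\mathcal{I}$, $V:\mathcal{P}\to2^W$; a pointed model is $(M,w_d)$ with $w_d\in W$. For $k\ge0$, a $k$-bisimulation between $(M,w_d)$ and $(M',w'_d)$ is a sequence of nonempty relations $Z_k\subseteq\cdots\subseteq Z_0\subseteq W\times W'$ with $(w_d,w'_d)\in Z_k$ such that pairs in $Z_0$ agree on all atoms, and for all $h<k$: if $(w,w')\in Z_{h+1}$ and $wR_iv$ then some $v'$ has $w'R'_iv'$, $(v,v')\in Z_h$ (forth), and symmetrically (back); $k$-bisimilar means such a sequence exists. For worlds of one model, $w\sim_hv$ means $(M,w),(M,v)$ are $h$-bisimilar; $[w]_h=\{v\in W\mid w\sim_hv\}$. With respect to $\mathcal{M}$ and $k$: depth $d(w)$ = length of a shortest path from $w_d$ to $w$ along edges of any $R_i$ ($\infty$ if none); bound $b(w)=k-d(w)$. For $x,y$ with nonnegative bound, $x\succ y$ iff $b(x)>b(y)$ and $x\sim_{b(y)}y$. $\mathrm{Max}(W)=\{x\in W\mid b(x)\ge0$ and no $y\in W$ has $y\succ x\}$. For $0\le h\le k$, the least $h$-representative of $w\in W$ is $\ell_h(w)=\min_<\{v\in\mathrm{Max}(W)\mid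 v\sim_h w\}$. The $k$-contraction of $\mathcal{M}$ with respect to $<$ is $((W',R',V'),[w_d]_{b(w_d)})$ with $W'=\{[x]_{b(x)}\mid x\in\mathrm{Max}(W)\}$; $R'_i=\{([x]_{b(x)},[\ell_{b(x)-1}(y)]_{b(\ell_{b(x)-1}(y))})\mid x\in\mathrm{Max}(W),\ xR_iy,\ b(x)>0\}$; $V'(p)=\{[x]_{b(x)}\mid x\in\mathrm{Max}(W),\ x\in V(p)\}$. *)

theory Defs
  imports Main "HOL-Library.Countable_Set" "HOL-Library.Extended_Nat"
begin

text \<open>
  The set \<open>P\<close> of atomic propositions and the set \<open>I\<close> of modality indices are explicit
  parameters (either may be empty). Only the values of \<open>rel M\<close> on \<open>I\<close> and of \<open>val M\<close> on \<open>P\<close>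
  are ever consulted.
\<close>

record ('p, 'i, 'w) model =
  worlds :: "'w set"
  rel :: "'i \<Rightarrow> ('w \<times> 'w) set"
  val :: "'p \<Rightarrow> 'w set"

definition is_model :: "'p set \<Rightarrow> 'i set \<Rightarrow> ('p, 'i, 'w) model \<Rightarrow> bool" where
  "is_model P I M \<longleftrightarrow>
     finite (worlds M) \<and> worlds M \<noteq> {} \<and>
     (\<forall>i\<in>I. rel M i \<subseteq> worlds M \<times> worlds M) \<and>
     (\<forall>p\<in>P. val M p \<subseteq> worlds M)"

type_synonym ('p, 'i, 'w) pmodel = "('p, 'i, 'w) model \<times> 'w"

definition is_pointed_model :: "'p set \<Rightarrow> 'i set \<Rightarrow> ('p, 'i, 'w) pmodel \<Rightarrow> bool" where
  "is_pointed_model P I = (\<lambda>(M, wd). is_model P I M \<and> wd \<in> worlds M)"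


text \<open>The sequence \<open>Z\<^sub>k \<subseteq> \<dots> \<subseteq> Z\<^sub>0\<close> is a function on \<open>nat\<close> of which only the values at
  \<open>0, \<dots>, k\<close> matter.\<close>

definition k_bisimulation ::
  "'p set \<Rightarrow> 'i set \<Rightarrow> nat \<Rightarrow> ('p, 'i, 'w) pmodel \<Rightarrow> ('p, 'i, 'v) pmodel \<Rightarrow>
   (nat \<Rightarrow> ('w \<times> 'v) set) \<Rightarrow> bool" where
  "k_bisimulation P I k = (\<lambda>(M, wd) (M', wd') Z.
     (\<forall>h\<le>k. Z h \<noteq> {}) \<and>
     (\<forall>h<k. Z (Suc h) \<subseteq> Z h) \<and>
     Z 0 \<subseteq> worlds M \<times> worlds M' \<and>
     (wd, wd') \<in> Z k \<and>
     (\<forall>(w, w')\<in>Z 0. \<forall>p\<in>P. w \<in> val M p \<longleftrightarrow> w' \<in> val M' p) \<and>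
     (\<forall>h<k. \<forall>(w, w')\<in>Z (Suc h). \<forall>i\<in>I.
        (\<forall>v. (w, v) \<in> rel M i \<longrightarrow> (\<exists>v'. (w', v') \<in> rel M' i \<and> (v, v') \<in> Z h)) \<and>
        (\<forall>v'. (w', v') \<in> rel M' i \<longrightarrow> (\<exists>v. (w, v) \<in> rel M i \<and> (v, v') \<in> Z h))))"

text \<open>Bisimilarity is a relation between pointed models, so that both sides are pointed models
  is part of it.\<close>

definition k_bisimilar ::
  "'p set \<Rightarrow> 'i set \<Rightarrow> nat \<Rightarrow> ('p, 'i, 'w) pmodel \<Rightarrow> ('p, 'i, 'v) pmodel \<Rightarrow> bool" where
  "k_bisimilar P I k X Y \<longleftrightarrow>
     is_pointed_model P I X \<and> is_pointed_model P I Y \<and> (\<exists>Z. k_bisimulation P I k X Y Z)"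

definition world_bisim ::
  "'p set \<Rightarrow> 'i set \<Rightarrow> ('p, 'i, 'w) model \<Rightarrow> nat \<Rightarrow> 'w \<Rightarrow> 'w \<Rightarrow> bool" where
  "world_bisim P I M h w v \<longleftrightarrow> k_bisimilar P I h (M, w) (M, v)"

definition bisim_class ::
  "'p set \<Rightarrow> 'i set \<Rightarrow> ('p, 'i, 'w) model \<Rightarrow> nat \<Rightarrow> 'w \<Rightarrow> 'w set" where
  "bisim_class P I M h w = {v \<in> worlds M. world_bisim P I M h w v}"


text \<open>The infimum of the empty set of lengths is \<open>\<infinity>\<close>, the depth of an unreachable world.\<close>

definition depth :: "'i set \<Rightarrow> ('p, 'i, 'w) pmodel \<Rightarrow> 'w \<Rightarrow> enat" where
  "depth I = (\<lambda>(M, wd) w. Inf {enat n | n. (wd, w) \<in> (\<Union>i\<in>I. rel M i) ^^ n})"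

text \<open>
  The bound \<open>k - d(w)\<close> may be negative or \<open>-\<infinity>\<close>, but its value is only used when it is
  nonnegative, that is, when \<open>d(w) \<le> k\<close>. That condition is \<open>nonneg_bound\<close>, and \<open>bound\<close> is
  the value as a natural number; it is meaningless without \<open>nonneg_bound\<close>.
\<close>

definition nonneg_bound :: "'i set \<Rightarrow> nat \<Rightarrow> ('p, 'i, 'w) pmodel \<Rightarrow> 'w \<Rightarrow> bool" where
  "nonneg_bound I k X w \<longleftrightarrow> depth I X w \<le> enat k"

definition bound :: "'i set \<Rightarrow> nat \<Rightarrow> ('p, 'i, 'w) pmodel \<Rightarrow> 'w \<Rightarrow> nat" where
  "bound I k X w = k - the_enat (depth I X w)"

text \<open>\<open>represents P I k X x y\<close> is \<open>x \<succ> y\<close>.\<close>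

definition represents ::
  "'p set \<Rightarrow> 'i set \<Rightarrow> nat \<Rightarrow> ('p, 'i, 'w) pmodel \<Rightarrow> 'w \<Rightarrow> 'w \<Rightarrow> bool" where
  "represents P I k X x y \<longleftrightarrow>
     nonneg_bound I k X x \<and> nonneg_bound I k X y \<and>
     bound I k X x > bound I k X y \<and>
     world_bisim P I (fst X) (bound I k X y) x y"

definition max_worlds ::
  "'p set \<Rightarrow> 'i set \<Rightarrow> nat \<Rightarrow> ('p, 'i, 'w) pmodel \<Rightarrow> 'w set" where
  "max_worlds P I k X =
     {x \<in> worlds (fst X). nonneg_bound I k X x \<and>
        \<not> (\<exists>y\<in>worlds (fst X). represents P I k X y x)}"

definition min_wrt :: "('w \<times> 'w) set \<Rightarrow> 'w set \<Rightarrow> 'w" where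
  "min_wrt r S = (THE m. m \<in> S \<and> (\<forall>v\<in>S. v \<noteq> m \<longrightarrow> (m, v) \<in> r))"

definition least_rep ::
  "'p set \<Rightarrow> 'i set \<Rightarrow> ('w \<times> 'w) set \<Rightarrow> nat \<Rightarrow> ('p, 'i, 'w) pmodel \<Rightarrow> nat \<Rightarrow> 'w \<Rightarrow> 'w" where
  "least_rep P I r k X h w =
     min_wrt r {v \<in> max_worlds P I k X. world_bisim P I (fst X) h v w}"

text \<open>\<open>rep_class P I k X x\<close> is \<open>[x]\<^bsub>b(x)\<^esub>\<close>.\<close>

definition rep_class ::
  "'p set \<Rightarrow> 'i set \<Rightarrow> nat \<Rightarrow> ('p, 'i, 'w) pmodel \<Rightarrow> 'w \<Rightarrow> 'w set" where
  "rep_class P I k X x = bisim_class P I (fst X) (bound I k X x) x"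

definition k_contraction ::
  "'p set \<Rightarrow> 'i set \<Rightarrow> ('w \<times> 'w) set \<Rightarrow> nat \<Rightarrow> ('p, 'i, 'w) pmodel \<Rightarrow>
   ('p, 'i, 'w set) pmodel" where
  "k_contraction P I r k X =
     (\<lparr> worlds = {rep_class P I k X x | x. x \<in> max_worlds P I k X},
        rel = (\<lambda>i. {(rep_class P I k X x,
                      rep_class P I k X (least_rep P I r k X (bound I k X x - 1) y)) | x y.
                      x \<in> max_worlds P I k X \<and> (x, y) \<in> rel (fst X) i \<and> bound I k X x > 0}),
        val = (\<lambda>p. {rep_class P I k X x | x. x \<in> max_worlds P I k X \<and> x \<in> val (fst X) p}) \<rparr>,
      rep_class P I k X (snd X))"

end

theory Submission
  imports Defs
begin

text \<open>
  Relate a world \<open>w\<close> to \<open>[x]\<^bsub>b(x)\<^esub>\<close> at level \<open>h\<close> when \<open>x\<close> is maximal, \<open>b(x) \<ge> h\<close> and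
  \<open>x \<sim>\<^sub>h w\<close>. The condition \<open>b(x) \<ge> h\<close> survives a step: if \<open>x R\<^sub>i y\<close> then
  \<open>b(y) \<ge> b(x) - 1\<close>, and a maximal world \<open>z \<sim> y\<close> at level \<open>b(x) - 1\<close> has
  \<open>b(z) \<ge> b(x) - 1\<close>, since otherwise \<open>y \<succ> z\<close>. The relation is compatible with the classes because
  maximal worlds with the same class have the same bound, again by maximality.
\<close>

section \<open>Bisimilarity inside one model, by recursion on the level\<close>

text \<open>The largest relation that can occur at level \<open>h\<close> of a bisimulation sequence
  on \<open>M\<close>. It refers to no witness sequence, so the laws of \<open>world_bisim\<close>
  become inductions on \<open>h\<close>. Stage \<open>Suc h\<close> includes stage \<open>h\<close>
  as a conjunct to make the chain decreasing.\<close>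

primrec bisim_approx ::
  "'p set \<Rightarrow> 'i set \<Rightarrow> ('p, 'i, 'w) model \<Rightarrow> nat \<Rightarrow> ('w \<times> 'w) set" where
  "bisim_approx P I M 0 =
     {(w, v). w \<in> worlds M \<and> v \<in> worlds M \<and> (\<forall>p\<in>P. w \<in> val M p \<longleftrightarrow> v \<in> val M p)}"
| "bisim_approx P I M (Suc h) =
     {(w, v). (w, v) \<in> bisim_approx P I M h \<and>
        (\<forall>i\<in>I. (\<forall>w'. (w, w') \<in> rel M i \<longrightarrow>
                    (\<exists>v'. (v, v') \<in> rel M i \<and> (w', v') \<in> bisim_approx P I M h)) \<and>
                (\<forall>v'. (v, v') \<in> rel M i \<longrightarrow>
                    (\<exists>w'. (w, w') \<in> rel M i \<and> (w', v') \<in> bisim_approx P I M h)))}"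

lemma bisim_approx_antimono:
  assumes "h \<le> j"
  shows "bisim_approx P I M j \<subseteq> bisim_approx P I M h"
  using assms by (induction rule: dec_induct) auto

text \<open>Forth and back from level \<open>Suc h\<close> land in \<open>Z h\<close>, which lies in
  the approximant by induction; the inclusion of \<open>Z (Suc h)\<close> in \<open>Z h\<close>
  supplies the remaining conjunct.\<close>

lemma k_bisimulation_subset_bisim_approx:
  assumes "k_bisimulation P I k (M, w) (M, v) Z" and "h \<le> k"
  shows "Z h \<subseteq> bisim_approx P I M h"
  using assms(2)
proof (induction h)
  case 0
  then show ?case using assms(1) by (fastforce simp: k_bisimulation_def)
next
  case (Suc h)
  then have IH: "Z h \<subseteq> bisim_approx P I M h" and "h < k" by auto
  show ?case
  proof (intro subrelI)
    fix a b assume ab: "(a, b) \<in> Z (Suc h)"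
    have "Z (Suc h) \<subseteq> Z h"
      using assms(1) \<open>h < k\<close> by (simp add: k_bisimulation_def)
    with ab IH have "(a, b) \<in> bisim_approx P I M h" by blast
    moreover have "\<forall>i\<in>I. (\<forall>w'. (a, w') \<in> rel M i \<longrightarrow> (\<exists>v'. (b, v') \<in> rel M i \<and> (w', v') \<in> Z h)) \<and>
        (\<forall>v'. (b, v') \<in> rel M i \<longrightarrow> (\<exists>w'. (a, w') \<in> rel M i \<and> (w', v') \<in> Z h))"
      using assms(1) \<open>h < k\<close> ab by (fastforce simp: k_bisimulation_def)
    ultimately show "(a, b) \<in> bisim_approx P I M (Suc h)"
      using IH by simp blast
  qed
qed

lemma world_bisim_iff_bisim_approx:
  assumes "is_model P I M"
  shows "world_bisim P I M h w v \<longleftrightarrow> (w, v) \<in> bisim_approx P I M h"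
proof
  assume "world_bisim P I M h w v"
  then obtain Z where Z: "k_bisimulation P I h (M, w) (M, v) Z"
    by (auto simp: world_bisim_def k_bisimilar_def)
  then have "(w, v) \<in> Z h" by (simp add: k_bisimulation_def)
  with k_bisimulation_subset_bisim_approx[OF Z order_refl]
  show "(w, v) \<in> bisim_approx P I M h" by blast
next
  assume wv: "(w, v) \<in> bisim_approx P I M h"
  \<comment> \<open>The approximants themselves serve as the witness sequence; the pair
    \<open>(w, v)\<close> shows that no level up to \<open>h\<close> is empty.\<close>
  then have wv_le: "(w, v) \<in> bisim_approx P I M j" if "j \<le> h" for j
    using bisim_approx_antimono[OF that] by blast
  have "bisim_approx P I M j \<noteq> {}" if "j \<le> h" for j
    using wv_le[OF that] by blast
  with wv have "k_bisimulation P I h (M, w) (M, v) (bisim_approx P I M)"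
    by (auto simp: k_bisimulation_def)
  moreover have "w \<in> worlds M" "v \<in> worlds M"
    using wv_le[of 0] by auto
  ultimately show "world_bisim P I M h w v"
    using assms by (auto simp: world_bisim_def k_bisimilar_def is_pointed_model_def)
qed

lemma bisim_approx_refl:
  assumes "is_model P I M" and "w \<in> worlds M"
  shows "(w, w) \<in> bisim_approx P I M h"
  using assms(2)
proof (induction h arbitrary: w)
  case (Suc h)
  \<comment> \<open>The induction hypothesis speaks of worlds only, so successors must be known to
    stay in the model.\<close>
  have "v \<in> worlds M" if "(w, v) \<in> rel M i" "i \<in> I" for v i
    using assms(1) that by (auto simp: is_model_def)
  with Suc show ?case by (simp; blast)
qed simp

lemma bisim_approx_sym:
  assumes "(w, v) \<in> bisim_approx P I M h"
  shows "(v, w) \<in> bisim_approx P I M h"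
  using assms
proof (induction h arbitrary: w v)
  case (Suc h)
  from Suc.prems Suc.IH show ?case by simp blast
qed auto

lemma bisim_approx_trans:
  assumes "(u, v) \<in> bisim_approx P I M h" and "(v, w) \<in> bisim_approx P I M h"
  shows "(u, w) \<in> bisim_approx P I M h"
  using assms
proof (induction h arbitrary: u v w)
  case (Suc h)
  from Suc.prems have "(u, w) \<in> bisim_approx P I M h" using Suc.IH by auto
  moreover have "\<exists>w'. (w, w') \<in> rel M i \<and> (u', w') \<in> bisim_approx P I M h"
    if "i \<in> I" "(u, u') \<in> rel M i" for i u'
  proof -
    from Suc.prems(1) that obtain v' where "(v, v') \<in> rel M i" "(u', v') \<in> bisim_approx P I M h"
      by simp blast
    with Suc.prems(2) Suc.IH \<open>i \<in> I\<close> show ?thesis by simp blast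
  qed
  moreover have "\<exists>u'. (u, u') \<in> rel M i \<and> (u', w') \<in> bisim_approx P I M h"
    if "i \<in> I" "(w, w') \<in> rel M i" for i w'
  proof -
    from Suc.prems(2) that obtain v' where "(v, v') \<in> rel M i" "(v', w') \<in> bisim_approx P I M h"
      by simp blast
    with Suc.prems(1) Suc.IH \<open>i \<in> I\<close> show ?thesis by simp blast
  qed
  ultimately show ?case by simp
qed auto

lemma world_bisim_refl:
  "is_model P I M \<Longrightarrow> w \<in> worlds M \<Longrightarrow> world_bisim P I M h w w"
  by (simp only: world_bisim_iff_bisim_approx) (rule bisim_approx_refl)

lemma world_bisim_sym:
  "is_model P I M \<Longrightarrow> world_bisim P I M h w v \<Longrightarrow> world_bisim P I M h v w"
  by (simp only: world_bisim_iff_bisim_approx) (rule bisim_approx_sym)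

lemma world_bisim_trans:
  "is_model P I M \<Longrightarrow> world_bisim P I M h u v \<Longrightarrow> world_bisim P I M h v w \<Longrightarrow>
   world_bisim P I M h u w"
  by (simp only: world_bisim_iff_bisim_approx) (rule bisim_approx_trans)

lemma world_bisim_antimono:
  "is_model P I M \<Longrightarrow> world_bisim P I M j w v \<Longrightarrow> h \<le> j \<Longrightarrow> world_bisim P I M h w v"
  by (simp only: world_bisim_iff_bisim_approx) (rule subsetD[OF bisim_approx_antimono])

lemma world_bisim_atoms:
  "is_model P I M \<Longrightarrow> world_bisim P I M h w v \<Longrightarrow> p \<in> P \<Longrightarrow> w \<in> val M p \<longleftrightarrow> v \<in> val M p"
  using world_bisim_antimono[of P I M h w v 0] by (simp add: world_bisim_iff_bisim_approx)

text \<open>Together with \<open>world_bisim_sym\<close> this also yields the back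
  condition.\<close>

lemma world_bisim_forth:
  assumes "is_model P I M" and "world_bisim P I M (Suc h) w v" and "i \<in> I" and "(w, w') \<in> rel M i"
  obtains v' where "(v, v') \<in> rel M i" and "world_bisim P I M h w' v'"
  using assms by (simp add: world_bisim_iff_bisim_approx[OF assms(1)]) blast

section \<open>Depth and bound\<close>

text \<open>In \<open>enat\<close> the infimum of the empty set is infinite, and that of a nonempty
  set is its least element. A finite depth is therefore attained by a path.\<close>

lemma depth_finite_path:
  assumes "depth I (M, wd) w = enat n"
  shows "(wd, w) \<in> (\<Union>i\<in>I. rel M i) ^^ n"
proof -
  let ?S = "{enat n | n. (wd, w) \<in> (\<Union>i\<in>I. rel M i) ^^ n}"
  have "Inf ?S = enat n" using assms by (simp add: depth_def)
  moreover from this have "?S \<noteq> {}"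
    by (metis Inf_enat_def enat.distinct(1))
  ultimately have "enat n \<in> ?S"
    by (metis (lifting) Inf_enat_def LeastI all_not_in_conv)
  then show ?thesis by simp
qed

lemma depth_le_path:
  assumes "(wd, w) \<in> (\<Union>i\<in>I. rel M i) ^^ n"
  shows "depth I (M, wd) w \<le> enat n"
  using assms by (auto simp: depth_def intro: Inf_lower)

text \<open>A shortest path to \<open>x\<close> followed by the edge to \<open>y\<close> shows that
  depth grows by at most one. A positive bound means that the depth of \<open>x\<close> is below
  \<open>k\<close>, so the depth of \<open>y\<close> is still at most \<open>k\<close>.\<close>

lemma bound_step:
  assumes "nonneg_bound I k (M, wd) x" and "bound I k (M, wd) x > 0"
    and "i \<in> I" and "(x, y) \<in> rel M i"
  shows "nonneg_bound I k (M, wd) y" and "bound I k (M, wd) x - 1 \<le> bound I k (M, wd) y"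
proof -
  obtain n where n: "depth I (M, wd) x = enat n"
    using assms(1) by (cases "depth I (M, wd) x") (auto simp: nonneg_bound_def)
  have "(x, y) \<in> (\<Union>i\<in>I. rel M i)" using assms(3,4) by blast
  with depth_finite_path[OF n] have "(wd, y) \<in> (\<Union>i\<in>I. rel M i) ^^ Suc n"
    by auto
  then have le: "depth I (M, wd) y \<le> enat (Suc n)" by (rule depth_le_path)
  then obtain m where m: "depth I (M, wd) y = enat m"
    by (cases "depth I (M, wd) y") auto
  have "m \<le> Suc n" "n < k" using le m n assms(2) by (auto simp: bound_def)
  then show "nonneg_bound I k (M, wd) y" "bound I k (M, wd) x - 1 \<le> bound I k (M, wd) y"
    using m n by (auto simp: nonneg_bound_def bound_def)
qed

lemma depth_root: "depth I (M, wd) wd = 0"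
  using depth_le_path[where n = 0 and w = wd and wd = wd] by (simp add: zero_enat_def[symmetric])

lemma bound_root: "bound I k (M, wd) wd = k"
  by (simp add: bound_def depth_root zero_enat_def)

lemma bound_le: "bound I k X w \<le> k"
  by (simp add: bound_def)

section \<open>Maximal worlds, least representatives and classes\<close>

text \<open>The root has bound \<open>k\<close>, the largest possible, so no world can have a
  strictly greater one.\<close>

lemma max_worlds_root:
  assumes "wd \<in> worlds M"
  shows "wd \<in> max_worlds P I k (M, wd)"
  using assms bound_le[of I k "(M, wd)"]
  by (auto simp: max_worlds_def represents_def nonneg_bound_def bound_root depth_root leD)

lemma min_wrt_in:
  assumes "finite S" and "S \<noteq> {}" and "S \<subseteq> A" and "strict_linear_order_on A r"
  shows "min_wrt r S \<in> S"
proof -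
  have tr: "trans r" and ir: "irrefl r" and tot: "total_on A r"
    using assms(4) by (auto simp: strict_linear_order_on_def)
  \<comment> \<open>Existence of a least element: a new element is compared with the least element
    of the rest, and transitivity carries the smaller one past all others.\<close>
  have "\<exists>m\<in>S. \<forall>v\<in>S. v \<noteq> m \<longrightarrow> (m, v) \<in> r"
    using assms(1-3)
  proof (induction S rule: finite_ne_induct)
    case (insert x F)
    then obtain m where m: "m \<in> F" "\<forall>v\<in>F. v \<noteq> m \<longrightarrow> (m, v) \<in> r" by blast
    have "m \<noteq> x" "m \<in> A" "x \<in> A" using m insert by auto
    then consider "(x, m) \<in> r" | "(m, x) \<in> r" using tot by (auto simp: total_on_def)
    then show ?case
    proof cases
      case 1
      then have "(x, v) \<in> r" if "v \<in> F" for v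
        using m(2) that tr by (cases "v = m") (auto dest: transD)
      then show ?thesis by auto
    next
      case 2
      then show ?thesis using m by auto
    qed
  qed auto
  then obtain m where m: "m \<in> S" "\<forall>v\<in>S. v \<noteq> m \<longrightarrow> (m, v) \<in> r" by blast
  \<comment> \<open>Uniqueness makes the definite description denote: two distinct least elements
    would precede each other.\<close>
  have "min_wrt r S = m" unfolding min_wrt_def
  proof (rule the_equality)
    fix m' assume m': "m' \<in> S \<and> (\<forall>v\<in>S. v \<noteq> m' \<longrightarrow> (m', v) \<in> r)"
    show "m' = m"
    proof (rule ccontr)
      assume "m' \<noteq> m"
      with m m' have "(m, m') \<in> r" "(m', m) \<in> r" by auto
      then show False using tr ir by (meson irrefl_def transD)
    qed
  qed (use m in blast)
  with m show ?thesis by simp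
qed

text \<open>Among the worlds bisimilar to \<open>y\<close> at level \<open>b(y)\<close> with bound
  at least \<open>b(y)\<close>, take one, \<open>z\<close>, of greatest bound. A world above
  \<open>z\<close> would agree with \<open>z\<close> up to \<open>b(z) \<ge> b(y)\<close>, so it
  would be another candidate, with a greater bound.\<close>

lemma max_worlds_representative:
  assumes "is_model P I M" and "y \<in> worlds M" and "nonneg_bound I k (M, wd) y"
  obtains z where "z \<in> max_worlds P I k (M, wd)"
    and "world_bisim P I M (bound I k (M, wd) y) z y"
proof -
  let ?b = "bound I k (M, wd)"
  let ?Q = "\<lambda>z. z \<in> worlds M \<and> nonneg_bound I k (M, wd) z \<and> ?b y \<le> ?b z \<and>
    world_bisim P I M (?b y) z y"
  have "?Q y" using assms by (simp add: world_bisim_refl)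
  \<comment> \<open>All bounds are at most \<open>k\<close>, so a greatest one exists among the
    candidates.\<close>
  moreover have "\<forall>z. ?Q z \<longrightarrow> ?b z < Suc k" by (simp add: bound_le less_Suc_eq_le)
  ultimately obtain z where z: "?Q z" "\<forall>x. ?Q x \<longrightarrow> ?b x \<le> ?b z"
    using ex_has_greatest_nat[of ?Q y ?b "Suc k"] by (metis less_imp_le)
  have "z \<in> max_worlds P I k (M, wd)"
  proof (rule ccontr)
    assume "z \<notin> max_worlds P I k (M, wd)"
    with z(1) obtain x where x: "x \<in> worlds M" "nonneg_bound I k (M, wd) x" "?b z < ?b x"
      "world_bisim P I M (?b z) x z"
      by (auto simp: max_worlds_def represents_def)
    from x(4) z(1) have "world_bisim P I M (?b y) x y"
      by (meson assms(1) world_bisim_antimono world_bisim_trans)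
    with x z(1) have "?Q x" by simp
    with z(2) x(3) show False by fastforce
  qed
  with z(1) that show thesis by blast
qed

text \<open>If \<open>b(z) < h \<le> b(y)\<close>, then lowering the bisimilarity from
  \<open>h\<close> to \<open>b(z)\<close> gives \<open>y \<succ> z\<close>, against the maximality
  of \<open>z\<close>.\<close>

lemma max_worlds_bound_ge:
  assumes "is_model P I M" and "z \<in> max_worlds P I k (M, wd)"
    and "y \<in> worlds M" and "nonneg_bound I k (M, wd) y"
    and "world_bisim P I M h z y" and "h \<le> bound I k (M, wd) y"
  shows "h \<le> bound I k (M, wd) z"
proof (rule ccontr)
  let ?b = "bound I k (M, wd)"
  assume less: "\<not> h \<le> ?b z"
  then have "world_bisim P I M (?b z) y z"
    using assms(1,5) by (meson linear world_bisim_antimono world_bisim_sym)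
  with less assms have "represents P I k (M, wd) y z"
    by (auto simp: represents_def max_worlds_def)
  with assms(2,3) show False by (auto simp: max_worlds_def)
qed

text \<open>Edges and valuation of the contraction are given through some maximal member of a class;
  this transfers facts between two such choices.\<close>

lemma rep_class_eq_iff:
  assumes "is_model P I M" and "x \<in> max_worlds P I k (M, wd)" and "y \<in> max_worlds P I k (M, wd)"
  shows "rep_class P I k (M, wd) x = rep_class P I k (M, wd) y \<longleftrightarrow>
    bound I k (M, wd) x = bound I k (M, wd) y \<and> world_bisim P I M (bound I k (M, wd) x) x y"
proof
  let ?b = "bound I k (M, wd)"
  have x: "x \<in> worlds M" "nonneg_bound I k (M, wd) x"
    and y: "y \<in> worlds M" "nonneg_bound I k (M, wd) y"
    using assms by (auto simp: max_worlds_def)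
  {
    assume eq: "rep_class P I k (M, wd) x = rep_class P I k (M, wd) y"
    \<comment> \<open>Each world lies in its own class, so equal classes give bisimilarity at both
      levels, \<open>b(x)\<close> and \<open>b(y)\<close>.\<close>
    have "x \<in> rep_class P I k (M, wd) x" "y \<in> rep_class P I k (M, wd) y"
      using assms(1) x y by (auto simp: rep_class_def bisim_class_def world_bisim_refl)
    with eq have xy: "world_bisim P I M (?b x) x y" and yx: "world_bisim P I M (?b y) y x"
      by (auto simp: rep_class_def bisim_class_def)
    \<comment> \<open>The maximality of \<open>y\<close> gives this inequality, and that of
      \<open>x\<close> the converse.\<close>
    have "?b x \<le> ?b y"
      using max_worlds_bound_ge[OF assms(1,3) x world_bisim_sym[OF assms(1) xy]] by simp
    moreover have "?b y \<le> ?b x"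
      using max_worlds_bound_ge[OF assms(1,2) y world_bisim_sym[OF assms(1) yx]] by simp
    ultimately show "?b x = ?b y \<and> world_bisim P I M (?b x) x y"
      using xy by simp
  next
    assume eq: "?b x = ?b y \<and> world_bisim P I M (?b x) x y"
    then have "world_bisim P I M (?b y) x v \<longleftrightarrow> world_bisim P I M (?b y) y v" for v
      using world_bisim_trans[OF assms(1)] world_bisim_sym[OF assms(1)] by metis
    with eq show "rep_class P I k (M, wd) x = rep_class P I k (M, wd) y"
      by (simp add: rep_class_def bisim_class_def)
  }
qed

text \<open>The properties of an edge's target in the contraction that keep the bisimulation going
  for \<open>h = b(x) - 1\<close> further steps.\<close>

lemma least_rep_successor:
  assumes "is_model P I M" and "strict_linear_order_on (worlds M) r"
    and "x \<in> max_worlds P I k (M, wd)" and "bound I k (M, wd) x > 0"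
    and "i \<in> I" and "(x, y) \<in> rel M i"
  defines "h \<equiv> bound I k (M, wd) x - 1"
  defines "z \<equiv> least_rep P I r k (M, wd) h y"
  shows "z \<in> max_worlds P I k (M, wd)" and "world_bisim P I M h z y"
    and "h \<le> bound I k (M, wd) z"
proof -
  have y: "y \<in> worlds M" using assms(1,5,6) by (auto simp: is_model_def)
  have "nonneg_bound I k (M, wd) x" using assms(3) by (simp add: max_worlds_def)
  note b = bound_step[OF this assms(4-6)]
  let ?S = "{v \<in> max_worlds P I k (M, wd). world_bisim P I M h v y}"
  \<comment> \<open>The minimum is over a nonempty set: a maximal representative of \<open>y\<close>
    at level \<open>b(y)\<close> also represents it at the lower level
    \<open>b(x) - 1\<close>.\<close>
  obtain z' where "z' \<in> max_worlds P I k (M, wd)" "world_bisim P I M (bound I k (M, wd) y) z' y"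
    using max_worlds_representative[OF assms(1) y b(1)] by blast
  then have "z' \<in> ?S"
    using world_bisim_antimono[OF assms(1)] b(2) by (simp add: h_def)
  moreover have "?S \<subseteq> worlds M" by (auto simp: max_worlds_def)
  moreover from this have "finite ?S"
    using assms(1) by (auto simp: is_model_def intro: finite_subset)
  ultimately have "min_wrt r ?S \<in> ?S" using min_wrt_in assms(2) by blast
  then show z: "z \<in> max_worlds P I k (M, wd)" "world_bisim P I M h z y"
    by (simp_all add: z_def least_rep_def)
  show "h \<le> bound I k (M, wd) z"
    using max_worlds_bound_ge[OF assms(1) z(1) y b(1) z(2)] b(2) by (simp add: h_def)
qed

section \<open>The contraction is a pointed model\<close>

text \<open>The worlds are an image of the finite set of maximal worlds; the root and all edge
  targets are classes of maximal worlds.\<close>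

lemma is_pointed_model_k_contraction:
  assumes "is_pointed_model P I (M, wd)" and "strict_linear_order_on (worlds M) r"
  shows "is_pointed_model P I (k_contraction P I r k (M, wd))"
proof -
  have M: "is_model P I M" "wd \<in> worlds M" using assms(1) by (auto simp: is_pointed_model_def)
  have "finite (max_worlds P I k (M, wd))"
    using M(1) by (auto simp: is_model_def max_worlds_def)
  then show ?thesis
    using max_worlds_root[OF M(2), of P I k] least_rep_successor(1)[OF M(1) assms(2)]
    by (fastforce simp: is_pointed_model_def is_model_def k_contraction_def)
qed

section \<open>The bisimulation between a model and its contraction\<close>

definition contraction_bisim ::
  "'p set \<Rightarrow> 'i set \<Rightarrow> nat \<Rightarrow> ('p, 'i, 'w) pmodel \<Rightarrow> nat \<Rightarrow> ('w \<times> 'w set) set" where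
  "contraction_bisim P I k X h =
     {(w, rep_class P I k X x) | w x.
        x \<in> max_worlds P I k X \<and> h \<le> bound I k X x \<and> world_bisim P I (fst X) h x w}"

lemma world_bisim_in_worlds:
  "world_bisim P I M h w v \<Longrightarrow> w \<in> worlds M \<and> v \<in> worlds M"
  by (simp add: world_bisim_def k_bisimilar_def is_pointed_model_def)

text \<open>The valuation at \<open>c\<close> may be witnessed by a maximal world \<open>x'\<close>
  other than \<open>x\<close>. Equal classes make the two bisimilar, hence they agree on
  atoms.\<close>

lemma contraction_bisim_atoms:
  assumes "is_model P I M" and "(w, c) \<in> contraction_bisim P I k (M, wd) 0" and "p \<in> P"
  shows "w \<in> val M p \<longleftrightarrow> c \<in> val (fst (k_contraction P I r k (M, wd))) p"
proof -
  obtain x where x: "x \<in> max_worlds P I k (M, wd)" "world_bisim P I M 0 x w"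
    and c: "c = rep_class P I k (M, wd) x"
    using assms(2) by (auto simp: contraction_bisim_def)
  have "c \<in> val (fst (k_contraction P I r k (M, wd))) p \<longleftrightarrow> x \<in> val M p"
  proof
    assume "c \<in> val (fst (k_contraction P I r k (M, wd))) p"
    then obtain x' where "x' \<in> max_worlds P I k (M, wd)" "x' \<in> val M p"
      "rep_class P I k (M, wd) x = rep_class P I k (M, wd) x'"
      using c by (auto simp: k_contraction_def)
    then show "x \<in> val M p"
      using rep_class_eq_iff[OF assms(1) x(1)] world_bisim_atoms[OF assms(1) _ assms(3)] by blast
  qed (use x(1) c in \<open>auto simp: k_contraction_def\<close>)
  with world_bisim_atoms[OF assms(1) x(2) assms(3)] show ?thesis by simp
qed

text \<open>The edge from \<open>w\<close> is matched by one from \<open>x\<close>, whose target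
  \<open>y\<close> is then replaced by its least representative at level
  \<open>b(x) - 1\<close>.\<close>

lemma contraction_bisim_forth:
  assumes "is_model P I M" and "strict_linear_order_on (worlds M) r"
    and "(w, c) \<in> contraction_bisim P I k (M, wd) (Suc h)"
    and "i \<in> I" and "(w, v) \<in> rel M i"
  shows "\<exists>c'. (c, c') \<in> rel (fst (k_contraction P I r k (M, wd))) i \<and>
    (v, c') \<in> contraction_bisim P I k (M, wd) h"
proof -
  let ?b = "bound I k (M, wd)"
  obtain x where x: "x \<in> max_worlds P I k (M, wd)" "Suc h \<le> ?b x" "world_bisim P I M (Suc h) x w"
    and c: "c = rep_class P I k (M, wd) x"
    using assms(3) by (auto simp: contraction_bisim_def)
  obtain y where y: "(x, y) \<in> rel M i" "world_bisim P I M h v y"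
    using world_bisim_forth[OF assms(1) world_bisim_sym[OF assms(1) x(3)] assms(4,5)] by blast
  let ?z = "least_rep P I r k (M, wd) (?b x - 1) y"
  \<comment> \<open>From \<open>Suc h \<le> b(x)\<close>: the contraction does have an edge here,
    and its target agrees with \<open>y\<close> at least up to \<open>h\<close>.\<close>
  have pos: "0 < ?b x" and le: "h \<le> ?b x - 1" using x(2) by auto
  note z = least_rep_successor[OF assms(1,2) x(1) pos assms(4) y(1)]
  have "world_bisim P I M h ?z v"
    using world_bisim_antimono[OF assms(1) z(2) le] world_bisim_sym[OF assms(1) y(2)]
    by (rule world_bisim_trans[OF assms(1)])
  with z le have "(v, rep_class P I k (M, wd) ?z) \<in> contraction_bisim P I k (M, wd) h"
    by (auto simp: contraction_bisim_def)
  moreover have "(c, rep_class P I k (M, wd) ?z) \<in> rel (fst (k_contraction P I r k (M, wd))) i"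
    using x(1) c pos y(1) by (auto simp: k_contraction_def)
  ultimately show ?thesis by blast
qed

lemma contraction_bisim_back:
  assumes "is_model P I M" and "strict_linear_order_on (worlds M) r"
    and "(w, c) \<in> contraction_bisim P I k (M, wd) (Suc h)"
    and "i \<in> I" and "(c, c') \<in> rel (fst (k_contraction P I r k (M, wd))) i"
  shows "\<exists>v. (w, v) \<in> rel M i \<and> (v, c') \<in> contraction_bisim P I k (M, wd) h"
proof -
  let ?b = "bound I k (M, wd)"
  obtain x where x: "x \<in> max_worlds P I k (M, wd)" "Suc h \<le> ?b x" "world_bisim P I M (Suc h) x w"
    and c: "c = rep_class P I k (M, wd) x"
    using assms(3) by (auto simp: contraction_bisim_def)
  \<comment> \<open>The edge comes from some maximal \<open>x'\<close> in place of \<open>x\<close>;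
    \<open>rep_class_eq_iff\<close> carries the bound and the bisimilarity with \<open>w\<close>
    over to \<open>x'\<close>.\<close>
  obtain x' y where x': "x' \<in> max_worlds P I k (M, wd)" "0 < ?b x'"
    and c_x': "c = rep_class P I k (M, wd) x'" and y: "(x', y) \<in> rel M i"
    and c': "c' = rep_class P I k (M, wd) (least_rep P I r k (M, wd) (?b x' - 1) y)"
    using assms(5) by (auto simp: k_contraction_def)
  let ?z = "least_rep P I r k (M, wd) (?b x' - 1) y"
  have eq: "?b x' = ?b x" "world_bisim P I M (?b x') x' x"
    using rep_class_eq_iff[OF assms(1) x'(1) x(1)] c c_x' by auto
  have "world_bisim P I M (Suc h) x' w"
    using eq x(2) by (intro world_bisim_trans[OF assms(1) _ x(3)])
      (auto intro: world_bisim_antimono[OF assms(1)])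
  \<comment> \<open>The back condition is the forth condition read from \<open>x'\<close> to
    \<open>w\<close>.\<close>
  then obtain v where v: "(w, v) \<in> rel M i" "world_bisim P I M h y v"
    using world_bisim_forth[OF assms(1) _ assms(4) y] by blast
  have le: "h \<le> ?b x' - 1" using x(2) eq(1) by simp
  note z = least_rep_successor[OF assms(1,2) x' assms(4) y]
  have "world_bisim P I M h ?z v"
    using world_bisim_antimono[OF assms(1) z(2) le] v(2) by (rule world_bisim_trans[OF assms(1)])
  with z le c' have "(v, c') \<in> contraction_bisim P I k (M, wd) h"
    by (auto simp: contraction_bisim_def)
  with v(1) show ?thesis by blast
qed

lemma k_bisimulation_contraction_bisim:
  assumes "is_pointed_model P I (M, wd)" and "strict_linear_order_on (worlds M) r"
  shows "k_bisimulation P I k (M, wd) (k_contraction P I r k (M, wd))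
    (contraction_bisim P I k (M, wd))"
proof -
  let ?C = "fst (k_contraction P I r k (M, wd))" and ?c = "rep_class P I k (M, wd) wd"
  let ?Z = "contraction_bisim P I k (M, wd)"
  have M: "is_model P I M" "wd \<in> worlds M" using assms(1) by (auto simp: is_pointed_model_def)
  \<comment> \<open>\<open>k_bisimulation\<close> matches on pairs, so the contraction is exposed as
    one.\<close>
  have C: "k_contraction P I r k (M, wd) = (?C, ?c)" by (simp add: k_contraction_def)
  \<comment> \<open>Since \<open>b(wd) = k\<close>, the root pair lies at every level up to
    \<open>k\<close>, which also makes those levels nonempty.\<close>
  have root: "(wd, ?c) \<in> ?Z h" if "h \<le> k" for h
  proof -
    show ?thesis
      using that max_worlds_root[OF M(2)] world_bisim_refl[OF M]
      by (auto simp: contraction_bisim_def bound_root)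
  qed
  have mono: "?Z (Suc h) \<subseteq> ?Z h" for h
    by (fastforce simp: contraction_bisim_def intro: world_bisim_antimono[OF M(1)])
  have sub: "?Z 0 \<subseteq> worlds M \<times> worlds ?C"
    by (auto simp: contraction_bisim_def k_contraction_def dest: world_bisim_in_worlds)
  have atoms: "\<forall>(w, c)\<in>?Z 0. \<forall>p\<in>P. w \<in> val M p \<longleftrightarrow> c \<in> val ?C p"
    using contraction_bisim_atoms[OF M(1)] by blast
  have step: "\<forall>(w, c)\<in>?Z (Suc h). \<forall>i\<in>I.
      (\<forall>v. (w, v) \<in> rel M i \<longrightarrow> (\<exists>c'. (c, c') \<in> rel ?C i \<and> (v, c') \<in> ?Z h)) \<and>
      (\<forall>c'. (c, c') \<in> rel ?C i \<longrightarrow> (\<exists>v. (w, v) \<in> rel M i \<and> (v, c') \<in> ?Z h))" for h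
    by (auto intro: contraction_bisim_forth[OF M(1) assms(2)]
        contraction_bisim_back[OF M(1) assms(2)] simp del: fst_conv)
  have nonempty: "?Z h \<noteq> {}" if "h \<le> k" for h using root[OF that] by blast
  have "k_bisimulation P I k (M, wd) (?C, ?c) ?Z"
    unfolding k_bisimulation_def prod.case
    by (intro conjI allI impI nonempty mono sub root[OF order_refl] atoms step)
  then show ?thesis by (simp only: C[symmetric])
qed

theorem theorem5p5:
  fixes P :: "'p set" and I :: "'i set"
    and M :: "('p, 'i, 'w) model" and wd :: 'w
    and less :: "('w \<times> 'w) set" and k :: nat
  assumes "countable P" and "finite I"
    and "is_pointed_model P I (M, wd)"
    and "less \<subseteq> worlds M \<times> worlds M" and "strict_linear_order_on (worlds M) less"
  shows "k_bisimilar P I k (M, wd) (k_contraction P I less k (M, wd))"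
  using assms(3) is_pointed_model_k_contraction[OF assms(3,5)]
    k_bisimulation_contraction_bisim[OF assms(3,5)]
  unfolding k_bisimilar_def by blast

end
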